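(* Let $P$ be a normed space, and assume that for any $\lambda \in \Lambda$ there exists $d(\lambda) \ge 0$ such that $|\langle \lambda, p \rangle| \le d(\lambda) \| p \|$ for all $p \in P$. Suppose also that $\liminf_{p \to 0} \sigma(p) / \| p \| > 0$, and that $\sigma$ has a valley at zero. Then an augmented Lagrange multiplier of $(\mathcal{P})$ exists if and only if there exist a neighbourhood $U \subset P$ of zero and $\lambda \in \Lambda$ such that the penalty function $F(x, r, U)$ is exact, and the function $\mathscr{L}(\cdot, \lambda, r)$ is bounded below on $A$ for some $r \ge 0$. Furthermore, if $\mathcal{A}(\mathcal{P}) \ne \emptyset$, then $\mathcal{A}(\mathcal{P})$ consists of all those $\lambda \in \Lambda$ for which $\mathscr{L}(\cdot, \lambda, r)$ is bounded below on $A$ for some $r \ge 0$.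
   Context: Setting. $X$ is a topological space, $A \subset X$ is a nonempty set, $f \colon X \to \mathbb{R} \cup \{+\infty\}$, and $(\mathcal{P})$ denotes the problem of minimizing $f(x)$ subject to $x \in A$. It is assumed that $\{x \in A \mid f(x) < +\infty\} \ne \emptyset$ and that the optimal value $f^* = \inf_{x \in A} f(x)$ is finite. $P$ is a topological vector space of parameters (here a normed space), $\Lambda$ is a vector space of multipliers, and $\langle \cdot, \cdot \rangle \colon \Lambda \times P \to \mathbb{R}$ is a bilinear coupling function. $\Phi \colon X \times P \to \overline{\mathbb{R}} = \mathbb{R} \cup \{\pm\infty\}$ is a fixed dualizing parameterization function for $f$, i.e. $\Phi(x, 0) = f(x)$ for all $x \in X$. $\sigma \colon P \to [0, +\infty]$ is a fixed augmenting function, i.e. $\sigma(0) = 0$ and $\sigma(p) > 0$ for all $p \in P \setminus \{0\}$. The optimal value function is $v(p) = \inf_{x \in A} \Phi(x, p)$, so $v(0) = f^*$. The augmented Lagrangian is $\mathscr{L}(x, \lambda, r) = \inf_{p \in P} ( \Phi(x, p) - \langle \lambda, p \rangle + r \sigma(p) )$ for $x \in X$, $\lambda \in \Lambda$, $r \ge 0$. A multiplier $\lambda \in \Lambda$ is an augmented Lagrange multiplier of $(\mathcal{P})$ if there exists $r \ge 0$ such that $v(p) \ge v(0) + \langle \lambda, p \rangle - r \sigma(p)$ for all $p \in P$. The set of all augmented Lagrange multipliers of $(\mathcal{P})$ is denoted $\mathcal{A}(\mathcal{P})$. $\sigma$ has a valley at zero if for any neighbourhood $U \subset P$ of zero there exists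 $\delta > 0$ such that $\sigma(p) \ge \delta$ for all $p \in P \setminus U$. For a nonempty set $C \subseteq P$, $x \in X$, $r \ge 0$, the penalty function is $F(x, r, C) = \inf_{p \in C} ( \Phi(x, p) + r \sigma(p) )$; it is called exact if there exists $r \ge 0$ such that $F(x, r, C) \ge f^*$ for all $x \in A$. *)

theory Defs
  imports "HOL-Analysis.Analysis"
begin

(* Extended-real conventions used below: in type ereal, \<infinity> + (-\<infinity>) = \<infinity> and 0 * \<infinity> = 0.
   So, for r > 0, a parameter p with \<sigma> p = \<infinity> contributes \<infinity> to an infimum of
   terms \<Phi> x p + r \<sigma> p, even if \<Phi> x p = -\<infinity>. *)

definition opt_value :: "'x set \<Rightarrow> ('x \<Rightarrow> ereal) \<Rightarrow> ereal" where
  "opt_value A f = (INF x\<in>A. f x)"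

definition dualizing_parameterization ::
  "('x \<Rightarrow> ereal) \<Rightarrow> ('x \<Rightarrow> 'p::zero \<Rightarrow> ereal) \<Rightarrow> bool" where
  "dualizing_parameterization f \<Phi> \<longleftrightarrow> (\<forall>x. \<Phi> x 0 = f x)"

definition augmenting_function :: "('p::zero \<Rightarrow> ereal) \<Rightarrow> bool" where
  "augmenting_function \<sigma> \<longleftrightarrow> \<sigma> 0 = 0 \<and> (\<forall>p. p \<noteq> 0 \<longrightarrow> \<sigma> p > 0)"

definition opt_value_fun :: "'x set \<Rightarrow> ('x \<Rightarrow> 'p \<Rightarrow> ereal) \<Rightarrow> 'p \<Rightarrow> ereal" where
  "opt_value_fun A \<Phi> p = (INF x\<in>A. \<Phi> x p)"

definition aug_lagrangian ::
  "('x \<Rightarrow> 'p \<Rightarrow> ereal) \<Rightarrow> ('l \<Rightarrow> 'p \<Rightarrow> real) \<Rightarrow> ('p \<Rightarrow> ereal) \<Rightarrow> 'x \<Rightarrow> 'l \<Rightarrow> real \<Rightarrow> ereal" where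
  "aug_lagrangian \<Phi> coup \<sigma> x \<mu> r = (INF p. \<Phi> x p - ereal (coup \<mu> p) + ereal r * \<sigma> p)"

definition is_aug_multiplier ::
  "'x set \<Rightarrow> ('x \<Rightarrow> 'p::zero \<Rightarrow> ereal) \<Rightarrow> ('l \<Rightarrow> 'p \<Rightarrow> real) \<Rightarrow> ('p \<Rightarrow> ereal) \<Rightarrow> 'l \<Rightarrow> bool" where
  "is_aug_multiplier A \<Phi> coup \<sigma> \<mu> \<longleftrightarrow>
     (\<exists>r\<ge>0. \<forall>p. opt_value_fun A \<Phi> p \<ge>
        opt_value_fun A \<Phi> 0 + ereal (coup \<mu> p) - ereal r * \<sigma> p)"

definition aug_multipliers ::
  "'x set \<Rightarrow> ('x \<Rightarrow> 'p::zero \<Rightarrow> ereal) \<Rightarrow> ('l \<Rightarrow> 'p \<Rightarrow> real) \<Rightarrow> ('p \<Rightarrow> ereal) \<Rightarrow> 'l set" where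
  "aug_multipliers A \<Phi> coup \<sigma> = {\<mu>. is_aug_multiplier A \<Phi> coup \<sigma> \<mu>}"

(* Neighbourhoods of zero are not required to be open. *)
definition valley_at_zero :: "('p::{zero,topological_space} \<Rightarrow> ereal) \<Rightarrow> bool" where
  "valley_at_zero \<sigma> \<longleftrightarrow>
     (\<forall>U. 0 \<in> interior U \<longrightarrow> (\<exists>\<delta>::real. \<delta> > 0 \<and> (\<forall>p\<in>- U. \<sigma> p \<ge> ereal \<delta>)))"

definition penalty_function ::
  "('x \<Rightarrow> 'p \<Rightarrow> ereal) \<Rightarrow> ('p \<Rightarrow> ereal) \<Rightarrow> 'x \<Rightarrow> real \<Rightarrow> 'p set \<Rightarrow> ereal" where
  "penalty_function \<Phi> \<sigma> x r C = (INF p\<in>C. \<Phi> x p + ereal r * \<sigma> p)"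

definition exact_penalty ::
  "'x set \<Rightarrow> ('x \<Rightarrow> ereal) \<Rightarrow> ('x \<Rightarrow> 'p \<Rightarrow> ereal) \<Rightarrow> ('p \<Rightarrow> ereal) \<Rightarrow> 'p set \<Rightarrow> bool" where
  "exact_penalty A f \<Phi> \<sigma> C \<longleftrightarrow>
     (\<exists>r\<ge>0. \<forall>x\<in>A. penalty_function \<Phi> \<sigma> x r C \<ge> opt_value A f)"

(* The lower bound must be a real number: bdd_below is vacuous in ereal, which has a least element. *)
definition bounded_below_on :: "'x set \<Rightarrow> ('x \<Rightarrow> ereal) \<Rightarrow> bool" where
  "bounded_below_on A g \<longleftrightarrow> (\<exists>c::real. \<forall>x\<in>A. g x \<ge> ereal c)"

end

theory Submission
  imports Defs
begin

text \<open>
  Near zero the growth condition gives \<open>\<sigma> p \<ge> a \<parallel>p\<parallel>\<close>, so \<open>|\<langle>\<lambda>, p\<rangle>| \<le> (d / a) \<sigma> p\<close>: there the linear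
  term of the multiplier inequality is absorbed by increasing \<open>r\<close>, and the inequality becomes
  exactness of the penalty function. Away from zero the valley condition gives \<open>\<sigma> p \<ge> \<delta>\<close>, so any
  constant is absorbed in the same way, and the inequality becomes boundedness below of the
  augmented Lagrangian. As exactness does not involve \<open>\<lambda>\<close>, a single multiplier suffices to
  turn every \<open>\<lambda>\<close> with bounded Lagrangian into a multiplier.
\<close>

lemma augmenting_function_nonneg:
  assumes "augmenting_function \<sigma>"
  shows "0 \<le> \<sigma> p"
  using assms unfolding augmenting_function_def by (cases "p = 0") (auto intro: less_imp_le)

text \<open>Any real \<open>a\<close> strictly between 0 and the lower limit bounds the ratio from
  below on a punctured ball. The filter \<open>at 0\<close> says nothing about the centre, so
  \<open>0 \<le> \<sigma> 0\<close> covers \<open>p = 0\<close>.\<close>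

lemma Liminf_ratio_pos_imp_linear_growth:
  fixes \<sigma> :: "'p::real_normed_vector \<Rightarrow> ereal"
  assumes "Liminf (at 0) (\<lambda>p. \<sigma> p / ereal (norm p)) > 0" and "0 \<le> \<sigma> 0"
  obtains a e :: real
  where "a > 0" "e > 0" "\<And>p. norm p < e \<Longrightarrow> ereal (a * norm p) \<le> \<sigma> p"
proof -
  obtain b where b: "0 < b" "b < Liminf (at 0) (\<lambda>p. \<sigma> p / ereal (norm p))"
    using assms(1) dense by blast
  obtain a where a: "0 < a" "ereal a < b"
    using b(1) ereal_dense2[of 0 b] by auto
  have "\<forall>\<^sub>F p in at 0. ereal a < \<sigma> p / ereal (norm p)"
    using less_LiminfD[OF order.strict_trans[OF a(2) b(2)]] .
  then obtain e where e: "e > 0"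
    "\<And>p. p \<noteq> 0 \<Longrightarrow> norm p < e \<Longrightarrow> ereal a < \<sigma> p / ereal (norm p)"
    unfolding eventually_at dist_norm diff_zero by blast
  have "ereal (a * norm p) \<le> \<sigma> p" if "norm p < e" for p
  proof (cases "p = 0")
    case True
    then show ?thesis using assms(2) by (simp add: zero_ereal_def)
  next
    case False
    then show ?thesis using e(2)[OF False that]
      by (cases "\<sigma> p") (auto simp: field_simps)
  qed
  then show thesis using that a(1) e(1) by blast
qed

lemma opt_value_fun_zero:
  assumes "dualizing_parameterization f \<Phi>"
  shows "opt_value_fun A \<Phi> 0 = opt_value A f"
  using assms unfolding dualizing_parameterization_def opt_value_fun_def opt_value_def by simp

text \<open>Replaces the infimum in the value function by a condition on each pair of
  \<open>x\<close> and \<open>p\<close>, so that later proofs reduce to arithmetic with the real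
  number \<open>c\<close>.\<close>

lemma is_aug_multiplier_iff:
  assumes "dualizing_parameterization f \<Phi>" and "opt_value A f = ereal c"
  shows "is_aug_multiplier A \<Phi> coup \<sigma> \<mu> \<longleftrightarrow>
    (\<exists>r\<ge>0. \<forall>x\<in>A. \<forall>p. ereal (c + coup \<mu> p) - ereal r * \<sigma> p \<le> \<Phi> x p)"
  unfolding is_aug_multiplier_def opt_value_fun_zero[OF assms(1)] assms(2)
  by (auto simp: opt_value_fun_def le_INF_iff)

text \<open>Rearranging the multiplier inequality shows that the optimal value \<open>c\<close> is
  itself a lower bound, with the same \<open>r\<close>.\<close>

lemma aug_multiplier_imp_bounded_below:
  assumes "dualizing_parameterization f \<Phi>" and "opt_value A f = ereal c"
    and "augmenting_function \<sigma>" and "is_aug_multiplier A \<Phi> coup \<sigma> \<mu>"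
  shows "\<exists>r\<ge>0. bounded_below_on A (\<lambda>x. aug_lagrangian \<Phi> coup \<sigma> x \<mu> r)"
proof -
  obtain r where r: "r \<ge> 0"
    "\<And>x p. x \<in> A \<Longrightarrow> ereal (c + coup \<mu> p) - ereal r * \<sigma> p \<le> \<Phi> x p"
    using assms(4) unfolding is_aug_multiplier_iff[OF assms(1,2)] by blast
  have "ereal c \<le> \<Phi> x p - ereal (coup \<mu> p) + ereal r * \<sigma> p" if "x \<in> A" for x p
    \<comment> \<open>The split on \<open>r = 0\<close> is due to
      \<open>\<sigma> p = \<infinity>\<close>: the penalty term is then 0 if \<open>r = 0\<close>
      and \<open>\<infinity>\<close> otherwise.\<close>
    using r(1) r(2)[OF that, of p] augmenting_function_nonneg[OF assms(3), of p]
    by (cases "r = 0"; cases "\<sigma> p"; cases "\<Phi> x p") auto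
  then have "bounded_below_on A (\<lambda>x. aug_lagrangian \<Phi> coup \<sigma> x \<mu> r)"
    unfolding bounded_below_on_def aug_lagrangian_def by (auto simp: le_INF_iff)
  with r(1) show ?thesis by blast
qed

lemma aug_multiplier_imp_exact_penalty:
  fixes \<Phi> :: "'x \<Rightarrow> 'p::real_normed_vector \<Rightarrow> ereal"
  assumes "dualizing_parameterization f \<Phi>" and "opt_value A f = ereal c"
    and "augmenting_function \<sigma>"
    and "d \<ge> 0" and d: "\<And>p. \<bar>coup \<mu> p\<bar> \<le> d * norm p"
    and "Liminf (at 0) (\<lambda>p. \<sigma> p / ereal (norm p)) > 0"
    and "is_aug_multiplier A \<Phi> coup \<sigma> \<mu>"
  shows "\<exists>U. 0 \<in> interior U \<and> exact_penalty A f \<Phi> \<sigma> U"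
proof -
  note nonneg = augmenting_function_nonneg[OF assms(3)]
  obtain r where r: "r \<ge> 0"
    "\<And>x p. x \<in> A \<Longrightarrow> ereal (c + coup \<mu> p) - ereal r * \<sigma> p \<le> \<Phi> x p"
    using assms(7) unfolding is_aug_multiplier_iff[OF assms(1,2)] by blast
  obtain a e where a: "a > 0" "e > 0" "\<And>p. norm p < e \<Longrightarrow> ereal (a * norm p) \<le> \<sigma> p"
    using Liminf_ratio_pos_imp_linear_growth[OF assms(6) nonneg] by blast
  \<comment> \<open>The term \<open>d / a\<close> pays for the coupling. The summand 1 makes
    \<open>R\<close> positive, so that \<open>R * \<sigma> p\<close> is infinite when
    \<open>\<sigma> p\<close> is, and the bound is then trivial.\<close>
  define R where "R = r + d / a + 1"
  have "R > 0" using r(1) \<open>d \<ge> 0\<close> a(1) by (simp add: R_def add_nonneg_pos)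
  have "ereal c \<le> \<Phi> x p + ereal R * \<sigma> p" if "x \<in> A" "norm p < e" for x p
  proof (cases "\<sigma> p")
    case (real s)
    have s: "s \<ge> 0" "a * norm p \<le> s" using nonneg[of p] a(3)[OF that(2)] real by auto
    have "d * norm p \<le> d / a * s"
      using mult_left_mono[OF s(2), of "d / a"] \<open>d \<ge> 0\<close> a(1) by simp
    then have "r * s - coup \<mu> p \<le> R * s"
      using d[of p] s(1) by (simp add: R_def algebra_simps)
    then show ?thesis using r(2)[OF that(1), of p] real
      by (cases "\<Phi> x p") auto
  qed (use nonneg[of p] \<open>R > 0\<close> in auto)
  then have "exact_penalty A f \<Phi> \<sigma> (ball 0 e)"
    unfolding exact_penalty_def penalty_function_def assms(2) using \<open>R > 0\<close>
    by (intro exI[of _ R]) (auto simp: le_INF_iff)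
  then show ?thesis using a(2) by (intro exI[of _ "ball 0 e"]) simp
qed

lemma exact_penalty_bounded_below_imp_aug_multiplier:
  fixes \<Phi> :: "'x \<Rightarrow> 'p::real_normed_vector \<Rightarrow> ereal"
  assumes "dualizing_parameterization f \<Phi>" and "opt_value A f = ereal c"
    and "augmenting_function \<sigma>"
    and "d \<ge> 0" and d: "\<And>p. \<bar>coup \<mu> p\<bar> \<le> d * norm p"
    and "Liminf (at 0) (\<lambda>p. \<sigma> p / ereal (norm p)) > 0"
    and "valley_at_zero \<sigma>"
    and "0 \<in> interior U" and "exact_penalty A f \<Phi> \<sigma> U"
    and "r\<^sub>2 \<ge> 0" and "bounded_below_on A (\<lambda>x. aug_lagrangian \<Phi> coup \<sigma> x \<mu> r\<^sub>2)"
  shows "is_aug_multiplier A \<Phi> coup \<sigma> \<mu>"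
proof -
  note nonneg = augmenting_function_nonneg[OF assms(3)]
  obtain r\<^sub>1 where r1: "r\<^sub>1 \<ge> 0"
    "\<And>x p. x \<in> A \<Longrightarrow> p \<in> U \<Longrightarrow> ereal c \<le> \<Phi> x p + ereal r\<^sub>1 * \<sigma> p"
    using assms(9) unfolding exact_penalty_def penalty_function_def assms(2) le_INF_iff by blast
  obtain m where m:
    "\<And>x p. x \<in> A \<Longrightarrow> ereal m \<le> \<Phi> x p - ereal (coup \<mu> p) + ereal r\<^sub>2 * \<sigma> p"
    using assms(11) unfolding bounded_below_on_def aug_lagrangian_def le_INF_iff by blast
  obtain a e where a: "a > 0" "e > 0" "\<And>p. norm p < e \<Longrightarrow> ereal (a * norm p) \<le> \<sigma> p"
    using Liminf_ratio_pos_imp_linear_growth[OF assms(6) nonneg] by blast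
  \<comment> \<open>Inside this intersection both exactness and linear growth are available; outside
    it the valley condition keeps \<open>\<sigma>\<close> above a positive
    \<open>\<delta>\<close>.\<close>
  have "0 \<in> interior (U \<inter> ball 0 e)" using assms(8) a(2) by simp
  then obtain \<delta> :: real where \<delta>: "\<delta> > 0" "\<And>p. p \<notin> U \<inter> ball 0 e \<Longrightarrow> ereal \<delta> \<le> \<sigma> p"
    using assms(7) unfolding valley_at_zero_def by blast
  \<comment> \<open>The two brackets are the penalties needed inside and outside the intersection.
    Both are nonnegative, so \<open>R\<close> dominates each of them; the summand 1 makes it
    positive for the case of infinite \<open>\<sigma> p\<close>.\<close>
  define R where "R = 1 + (r\<^sub>1 + d / a) + (r\<^sub>2 + \<bar>m - c\<bar> / \<delta>)"
  have parts: "0 \<le> r\<^sub>1 + d / a" "0 \<le> r\<^sub>2 + \<bar>m - c\<bar> / \<delta>"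
    using r1(1) assms(4,10) a(1) \<delta>(1) by simp_all
  then have "R > 0" by (simp add: R_def)
  have "ereal (c + coup \<mu> p) - ereal R * \<sigma> p \<le> \<Phi> x p" if "x \<in> A" for x p
  proof (cases "\<sigma> p")
    case (real s)
    have s: "s \<ge> 0" using nonneg[of p] real by auto
    show ?thesis
    proof (cases "p \<in> U \<inter> ball 0 e")
      case True
      then have "a * norm p \<le> s" using a(3)[of p] real by auto
      then have "d * norm p \<le> d / a * s"
        using mult_left_mono[of "a * norm p" s "d / a"] \<open>d \<ge> 0\<close> a(1) by simp
      moreover have "(r\<^sub>1 + d / a) * s \<le> R * s"
        using parts s by (intro mult_right_mono) (simp_all add: R_def)
      \<comment> \<open>Of the penalty \<open>R * s\<close>, the part \<open>d / a * s\<close>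
        absorbs the coupling and \<open>r\<^sub>1 * s\<close> remains for exactness.\<close>
      ultimately have "coup \<mu> p - R * s \<le> - (r\<^sub>1 * s)"
        using d[of p] by (simp add: algebra_simps)
      then show ?thesis using r1(2)[OF that, of p] True real
        by (cases "\<Phi> x p") auto
    next
      case False
      then have "\<delta> \<le> s" using \<delta>(2)[of p] real by auto
      then have "\<bar>m - c\<bar> \<le> \<bar>m - c\<bar> / \<delta> * s"
        using mult_left_mono[of \<delta> s "\<bar>m - c\<bar> / \<delta>"] \<delta>(1) by simp
      moreover have "(r\<^sub>2 + \<bar>m - c\<bar> / \<delta>) * s \<le> R * s"
        using parts s by (intro mult_right_mono) (simp_all add: R_def)
      \<comment> \<open>The coupling occurs both in the Lagrangian bound \<open>m\<close> and in the
        goal and cancels, so only the gap between \<open>c\<close> and \<open>m\<close> has to be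
        absorbed, which \<open>\<delta> \<le> s\<close> makes possible.\<close>
      ultimately have "c - R * s \<le> m - r\<^sub>2 * s"
        by (simp add: algebra_simps)
      then show ?thesis using m[OF that, of p] real
        by (cases "\<Phi> x p") auto
    qed
  qed (use nonneg[of p] \<open>R > 0\<close> in auto)
  then show ?thesis
    unfolding is_aug_multiplier_iff[OF assms(1,2)] using \<open>R > 0\<close> less_imp_le by blast
qed

theorem proposition6:
  fixes A :: "'x::topological_space set"
    and f :: "'x \<Rightarrow> ereal"
    and \<Phi> :: "'x \<Rightarrow> 'p::real_normed_vector \<Rightarrow> ereal"
    and coup :: "'l::real_vector \<Rightarrow> 'p \<Rightarrow> real"
    and \<sigma> :: "'p \<Rightarrow> ereal"
  assumes "A \<noteq> {}"
    and "\<forall>x. f x \<noteq> -\<infinity>"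
    and "{x \<in> A. f x < \<infinity>} \<noteq> {}"
    and "\<bar>opt_value A f\<bar> \<noteq> \<infinity>"
    and "bilinear coup"
    and "dualizing_parameterization f \<Phi>"
    and "augmenting_function \<sigma>"
    and "\<forall>\<mu>. \<exists>d\<ge>0. \<forall>p. \<bar>coup \<mu> p\<bar> \<le> d * norm p"
    and "Liminf (at 0) (\<lambda>p. \<sigma> p / ereal (norm p)) > 0"
    and "valley_at_zero \<sigma>"
  shows "((\<exists>\<mu>. is_aug_multiplier A \<Phi> coup \<sigma> \<mu>) \<longleftrightarrow>
           (\<exists>U \<mu>. 0 \<in> interior U \<and> exact_penalty A f \<Phi> \<sigma> U \<and>
              (\<exists>r\<ge>0. bounded_below_on A (\<lambda>x. aug_lagrangian \<Phi> coup \<sigma> x \<mu> r))))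
       \<and> (aug_multipliers A \<Phi> coup \<sigma> \<noteq> {} \<longrightarrow>
           aug_multipliers A \<Phi> coup \<sigma> =
             {\<mu>. \<exists>r\<ge>0. bounded_below_on A (\<lambda>x. aug_lagrangian \<Phi> coup \<sigma> x \<mu> r)})"
proof -
  obtain c where c: "opt_value A f = ereal c"
    using assms(4) by (cases "opt_value A f") auto
  let ?M = "is_aug_multiplier A \<Phi> coup \<sigma>"
  let ?B = "\<lambda>\<mu>. \<exists>r\<ge>0. bounded_below_on A (\<lambda>x. aug_lagrangian \<Phi> coup \<sigma> x \<mu> r)"
  let ?E = "\<exists>U. 0 \<in> interior U \<and> exact_penalty A f \<Phi> \<sigma> U"
  have B: "?B \<mu>" if "?M \<mu>" for \<mu>
    using aug_multiplier_imp_bounded_below[OF assms(6) c assms(7) that] .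
  have E: ?E if "?M \<mu>" for \<mu>
    using aug_multiplier_imp_exact_penalty[OF assms(6) c assms(7) _ _ assms(9) that] assms(8)
    by blast
  have M: "?M \<mu>" if E: "?E" and B: "?B \<mu>" for \<mu>
  proof -
    obtain d where d: "d \<ge> 0" "\<And>p. \<bar>coup \<mu> p\<bar> \<le> d * norm p"
      using assms(8) by blast
    obtain U where U: "0 \<in> interior U" "exact_penalty A f \<Phi> \<sigma> U"
      using E by blast
    obtain r where r: "r \<ge> 0" "bounded_below_on A (\<lambda>x. aug_lagrangian \<Phi> coup \<sigma> x \<mu> r)"
      using B by blast
    show ?thesis
      using exact_penalty_bounded_below_imp_aug_multiplier
        [OF assms(6) c assms(7) d assms(9,10) U r] .
  qed
  \<comment> \<open>For the set equality, any one multiplier yields \<open>?E\<close> through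
    \<open>E\<close>; then \<open>M\<close> and \<open>B\<close> give the two inclusions.\<close>
  show ?thesis
    unfolding aug_multipliers_def using B E M by blast
qed

end
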